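(* Let $p,q\in(0,1)$, let $p_{\alpha^{s}_0},p_{\alpha^{s}_1}\in(0,1]$ be the sampling probabilities and $p_{s_0},p_{s_1}\in[0,1]$ the success probabilities of the state-aware randomized stationary policy, write $a_i=p_{\alpha^{s}_i}p_{s_i}$ for $i=0,1$, and assume $\Phi=p\,a_1(1-a_0)+a_0\big(q+(1-q)a_1\big)>0$. Let $(X(t),\hat X(t))$ be in its stationary regime with stationary distribution $\pi_{i,j}$, and let $C_S(t)$ be the importance-aware consecutive error. Then: 1. $$\Pr[C_S(t)=i]=\begin{cases}1-\pi_{1,0}, & i=0,\\ p(1-q)^{i-1}(1-a_1)^{i}\,\pi_{0,0}, & i\ge 1.\end{cases}$$ 2. The transition probabilities $P^{S}_{i,i+1}=\Pr[C_S(t+1)=i+1\mid C_S(t)=i]$ (for those $i$ with $\Pr[C_S(t)=i]>0$) are $$P^{S}_{0,1}=\frac{p(1-a_1)\pi_{0,0}}{1-\pi_{1,0}},\qquad P^{S}_{i,i+1}=(1-q)(1-a_1)\quad (i\ge1).$$ 3. The average importance-aware consecutive error $\bar C_S=\sum_{x\ge1}x\Pr[C_S(t)=x]$ equals $$\bar C_S=\frac{pq\,a_0(1-a_1)}{(p+q)\big(q+(1-q)a_1\big)\Phi}.$$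
   Context: The source $X(t)$ is a discrete-time Markov chain on $\{0,1\}$ with $\Pr[X(t+1)=1\mid X(t)=0]=p$ and $\Pr[X(t+1)=0\mid X(t)=1]=q$ (self-transition probabilities $1-p$ and $1-q$). State-aware randomized stationary policy: in each slot $t+1$, if $X(t+1)=i$, then, independently of everything else, the source is sampled and the sample transmitted (in the same slot) with probability $p_{\alpha^{s}_i}$, and otherwise nothing is sent; a transmission made when the source is in state $i$ succeeds with probability $p_{s_i}$, independently of everything else. The reconstructed source satisfies $\hat X(t+1)=X(t+1)$ if a transmission succeeds in slot $t+1$, and $\hat X(t+1)=\hat X(t)$ otherwise. The stationary distribution $\pi_{i,j}$ (probability of $X(t)=i,\hat X(t)=j$) of the chain $(X(t),\hat X(t))$ is, with $a_i=p_{\alpha^{s}_i}p_{s_i}$ and $\Phi$ as in the claim, $\pi_{0,0}=\frac{q a_0[q+(1-q)a_1]}{(p+q)\Phi}$, $\pi_{0,1}=\frac{pq a_1(1-a_0)}{(p+q)\Phi}$, $\pi_{1,0}=\frac{pq a_0(1-a_1)}{(p+q)\Phi}$, $\pi_{1,1}=\frac{p a_1[p+(1-p)a_0]}{(p+q)\Phi}$. The importance-aware consecutive error $C_S(t)$ counts the consecutive slots, up to and including $t$, spent in the particular erroneous state $X=1,\hat X=0$: $C_S(t+1)=C_S(t)+1$ if $X(t+1)=1$ and $\hat X(t+1)=0$, and $C_S(t+1)=0$ otherwise. In the stationary regime (which may be taken two-sided), $C_S(t)=i\ge1$ means $(X,\hat X)=(1,0)$ at slots $t-i+1,\dots,t$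 and $(X,\hat X)\neq(1,0)$ at slot $t-i$. *)

theory Defs
  imports "HOL-Probability.Probability"
begin

text \<open>
  States of the source and of its reconstruction are Booleans: \<open>False\<close> is state 0, \<open>True\<close> is
  state 1. A state of the joint chain is a pair (source, reconstruction).
\<close>

definition source_step :: "real \<Rightarrow> real \<Rightarrow> bool \<Rightarrow> bool pmf" where
  "source_step p q x = bernoulli_pmf (if x then 1 - q else p)"

text \<open>
  One slot under the policy: \<open>\<alpha> i\<close> is the sampling probability and \<open>s i\<close> the success probability
  when the new source state is \<open>i\<close>.
\<close>

definition joint_step ::
    "real \<Rightarrow> real \<Rightarrow> (bool \<Rightarrow> real) \<Rightarrow> (bool \<Rightarrow> real) \<Rightarrow> bool \<times> bool \<Rightarrow> (bool \<times> bool) pmf" where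
  "joint_step p q \<alpha> s z =
     bind_pmf (source_step p q (fst z)) (\<lambda>x'.
     bind_pmf (bernoulli_pmf (\<alpha> x')) (\<lambda>transmit.
     bind_pmf (if transmit then bernoulli_pmf (s x') else return_pmf False) (\<lambda>success.
     return_pmf (x', if success then x' else snd z))))"

definition stationary_distribution :: "('s \<Rightarrow> 's pmf) \<Rightarrow> 's pmf \<Rightarrow> bool" where
  "stationary_distribution K \<pi> \<longleftrightarrow> bind_pmf \<pi> K = \<pi>"

text \<open>Two-sided Markov chains: \<open>z k\<close> is the state \<open>k\<close> slots before the present slot \<open>t\<close>.\<close>

definition markov_chain :: "'a measure \<Rightarrow> ('s \<Rightarrow> 's pmf) \<Rightarrow> (int \<Rightarrow> 'a \<Rightarrow> 's) \<Rightarrow> bool" where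
  "markov_chain M K Z \<longleftrightarrow>
     prob_space M \<and>
     (\<forall>t. Z t \<in> measurable M (count_space UNIV)) \<and>
     (\<forall>t n z y. \<P>(\<omega> in M. \<forall>k\<le>n. Z (t - int k) \<omega> = z k) > 0 \<longrightarrow>
        \<P>(\<omega> in M. Z (t + 1) \<omega> = y \<bar> \<forall>k\<le>n. Z (t - int k) \<omega> = z k) = pmf (K (z 0)) y)"

definition stationary_regime ::
    "'a measure \<Rightarrow> ('s \<Rightarrow> 's pmf) \<Rightarrow> 's pmf \<Rightarrow> (int \<Rightarrow> 'a \<Rightarrow> 's) \<Rightarrow> bool" where
  "stationary_regime M K \<pi> Z \<longleftrightarrow>
     markov_chain M K Z \<and> stationary_distribution K \<pi> \<and>
     (\<forall>t. distr M (count_space UNIV) (Z t) = measure_pmf \<pi>)"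

text \<open>
  Since \<open>C\<close> takes values in the natural numbers, the recursion over all integer times determines
  it: it cannot hold along a path that has been in error at all past slots. Such paths form a null
  set, hence the recursion is only required almost everywhere.
\<close>

definition importance_aware_consecutive_error ::
    "'a measure \<Rightarrow> (int \<Rightarrow> 'a \<Rightarrow> bool) \<Rightarrow> (int \<Rightarrow> 'a \<Rightarrow> bool) \<Rightarrow> (int \<Rightarrow> 'a \<Rightarrow> nat) \<Rightarrow> bool" where
  "importance_aware_consecutive_error M X Xhat C \<longleftrightarrow>
     (\<forall>t. C t \<in> measurable M (count_space UNIV)) \<and>
     (AE \<omega> in M. \<forall>t. C (t + 1) \<omega> =
        (if X (t + 1) \<omega> = True \<and> Xhat (t + 1) \<omega> = False then C t \<omega> + 1 else 0))"

end

theory Submission imports Defs begin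

text \<open>
  Almost surely \<open>C t > n\<close> means that the chain was in the erroneous state at the slots
  \<open>t - n, \<dots>, t\<close>, so by the Markov property the tail of \<open>C t\<close> is geometric with the probability of
  staying in error as its ratio. The point probabilities are differences of tails, and the
  transition probabilities are quotients of point probabilities because a positive value of
  \<open>C (t + 1)\<close> determines \<open>C t\<close>. The mean needs, in addition, the balance equations, which
  determine the stationary distribution.
\<close>

text \<open>Sampling and transmission enter only through the product
  \<open>\<alpha> x' * s x'\<close>, the probability of a successful update. A success sets the
  reconstruction to \<open>x'\<close> and a failure leaves it at \<open>y\<close>. When
  \<open>y = x'\<close> both outcomes lead to the same state, hence a sum of two indicator terms
  instead of a case distinction.\<close>

lemma pmf_joint_step:
  assumes "0 \<le> p" "p \<le> 1" "0 \<le> q" "q \<le> 1"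
    and "\<And>i. 0 \<le> \<alpha> i \<and> \<alpha> i \<le> 1" and "\<And>i. 0 \<le> s i \<and> s i \<le> 1"
  shows "pmf (joint_step p q \<alpha> s (x, y)) (x', y') =
    pmf (source_step p q x) x' *
      (\<alpha> x' * s x' * of_bool (y' = x') + (1 - \<alpha> x' * s x') * of_bool (y' = y))"
  using assms
  by (cases x; cases x'; cases y; cases y')
     (simp_all add: joint_step_def source_step_def pmf_bind algebra_simps)

lemma stationary_distribution_balance:
  fixes \<pi> :: "'s::finite pmf"
  assumes "stationary_distribution K \<pi>"
  shows "pmf \<pi> y = (\<Sum>z\<in>UNIV. pmf \<pi> z * pmf (K z) y)"
proof -
  have "pmf \<pi> y = pmf (bind_pmf \<pi> K) y"
    using assms by (simp add: stationary_distribution_def)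
  also have "\<dots> = (\<Sum>z\<in>UNIV. pmf \<pi> z * pmf (K z) y)"
    by (simp add: pmf_bind integral_measure_pmf_real[where A = UNIV] mult.commute)
  finally show ?thesis .
qed

lemma sum_bool_pairs:
  fixes f :: "bool \<times> bool \<Rightarrow> real"
  shows "(\<Sum>z\<in>UNIV. f z) = f (False, False) + f (False, True) + f (True, False) + f (True, True)"
proof -
  have pairs: "(UNIV :: (bool \<times> bool) set) = {(False, False), (False, True), (True, False), (True, True)}"
    by auto
  show ?thesis unfolding pairs by (simp add: add.assoc)
qed

text \<open>Splits off the index 0, that is, the most recent slot, so that inductions on the window
  length can step back in time.\<close>

lemma all_le_Suc_shift: "(\<forall>k\<le>Suc n. P k) \<longleftrightarrow> P 0 \<and> (\<forall>k\<le>n. P (Suc k))"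
  using All_less_Suc2[of "Suc n" P] by (simp add: less_Suc_eq_le)

text \<open>The \<open>n + 1\<close> slots involve \<open>n\<close> transitions, each contributing
  the self-transition probability of \<open>e\<close>. The induction splits off slot
  \<open>t\<close> and conditions on the window that ends at slot \<open>t - 1\<close>, so
  \<open>t\<close> has to vary.\<close>

lemma prob_constant_path:
  assumes "stationary_regime M K \<pi> Z"
  shows "\<P>(\<omega> in M. \<forall>k\<le>n. Z (t - int k) \<omega> = e) = pmf \<pi> e * pmf (K e) e ^ n"
proof -
  have mc: "markov_chain M K Z"
    and distr: "\<And>t. distr M (count_space UNIV) (Z t) = measure_pmf \<pi>"
    using assms by (auto simp: stationary_regime_def)
  have meas [measurable]: "Z t \<in> measurable M (count_space UNIV)" for t
    using mc by (simp add: markov_chain_def)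
  have markov: "\<P>(\<omega> in M. Z (t + 1) \<omega> = y \<bar> \<forall>k\<le>n. Z (t - int k) \<omega> = z k) = pmf (K (z 0)) y"
    if "\<P>(\<omega> in M. \<forall>k\<le>n. Z (t - int k) \<omega> = z k) > 0" for t n z y
    using mc that unfolding markov_chain_def by blast
  interpret prob_space M using mc by (simp add: markov_chain_def)
  show ?thesis
  proof (induction n arbitrary: t)
    case 0
    have "pmf \<pi> e = measure (distr M (count_space UNIV) (Z t)) {e}"
      by (simp add: distr measure_pmf_single)
    also have "\<dots> = \<P>(\<omega> in M. Z t \<omega> = e)"
      by (subst measure_distr) (auto intro!: arg_cong[where f = "measure M"])
    finally show ?case by simp
  next
    case (Suc n)
    let ?H = "\<lambda>\<omega>. \<forall>k\<le>n. Z (t - 1 - int k) \<omega> = e"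
    have split: "(\<forall>k\<le>Suc n. Z (t - int k) \<omega> = e) \<longleftrightarrow> Z t \<omega> = e \<and> ?H \<omega>" for \<omega>
      by (simp add: all_le_Suc_shift diff_diff_eq)
    have "\<P>(\<omega> in M. Z t \<omega> = e \<and> ?H \<omega>) = pmf (K e) e * \<P>(\<omega> in M. ?H \<omega>)"
    proof (cases "\<P>(\<omega> in M. ?H \<omega>) > 0")
      case True
      then have "\<P>(\<omega> in M. Z (t - 1 + 1) \<omega> = e \<bar> ?H \<omega>) = pmf (K e) e"
        by (intro markov[where z = "\<lambda>_. e"]) simp
      with True show ?thesis
        by (simp add: cond_prob_def field_simps)
    next
      \<comment> \<open>The Markov property says nothing about a null history, but then both sides
        vanish.\<close>
      case False
      then have H0: "\<P>(\<omega> in M. ?H \<omega>) = 0"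
        using measure_nonneg[of M "{\<omega> \<in> space M. ?H \<omega>}"] by linarith
      have "\<P>(\<omega> in M. Z t \<omega> = e \<and> ?H \<omega>) \<le> \<P>(\<omega> in M. ?H \<omega>)"
        by (intro finite_measure_mono) auto
      then show ?thesis
        using H0 by (simp add: measure_le_0_iff)
    qed
    then show ?case unfolding split Suc.IH by (simp add: mult_ac)
  qed
qed

text \<open>The count at \<open>t\<close> is positive exactly if \<open>P t\<close> holds, whatever
  its previous value, so unrolling the recursion ends after finitely many slots and no initial value
  enters.\<close>

lemma consecutive_count_gt_iff:
  fixes c :: "int \<Rightarrow> nat"
  assumes rec: "\<And>t. c (t + 1) = (if P (t + 1) then c t + 1 else 0)"
  shows "n < c t \<longleftrightarrow> (\<forall>k\<le>n. P (t - int k))"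
proof (induction n arbitrary: t)
  case 0
  show ?case using rec[of "t - 1"] by simp
next
  case (Suc n)
  have "Suc n < c t \<longleftrightarrow> P t \<and> n < c (t - 1)"
    using rec[of "t - 1"] by simp
  also have "\<dots> \<longleftrightarrow> (\<forall>k\<le>Suc n. P (t - int k))"
    by (simp add: Suc.IH all_le_Suc_shift diff_diff_eq)
  finally show ?case .
qed

text \<open>The differentiated geometric series, reindexed by \<open>Suc\<close>.\<close>

lemma has_sum_geometric_mean:
  fixes c :: real
  assumes "0 \<le> c" "c < 1"
  shows "((\<lambda>x. real x * c ^ (x - 1)) has_sum (1 / (1 - c)\<^sup>2)) {1..}"
proof -
  have "(\<lambda>n. of_nat (Suc n) * c ^ n) sums (1 / (1 - c)\<^sup>2)"
    using assms by (intro geometric_deriv_sums) simp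
  then have "((\<lambda>n. real (Suc n) * c ^ n) has_sum (1 / (1 - c)\<^sup>2)) UNIV"
    using assms by (intro sums_nonneg_imp_has_sum) auto
  then have "(((\<lambda>x. real x * c ^ (x - 1)) \<circ> Suc) has_sum (1 / (1 - c)\<^sup>2)) UNIV"
    by (simp add: o_def)
  moreover have "Suc ` UNIV = {1..}"
    by (auto simp: image_iff dest: Suc_le_D)
  ultimately show ?thesis
    using has_sum_reindex[of Suc UNIV] by (metis inj_Suc)
qed

theorem mainTheorem3:
  fixes M :: "'a measure"
    and p q \<Phi> :: real
    and \<alpha> s a :: "bool \<Rightarrow> real"
    and \<pi> :: "(bool \<times> bool) pmf"
    and X Xhat :: "int \<Rightarrow> 'a \<Rightarrow> bool"
    and C :: "int \<Rightarrow> 'a \<Rightarrow> nat"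
    and t :: int
  assumes p: "0 < p" "p < 1"
    and q: "0 < q" "q < 1"
    and \<alpha>: "\<And>i. 0 < \<alpha> i \<and> \<alpha> i \<le> 1"
    and s: "\<And>i. 0 \<le> s i \<and> s i \<le> 1"
    and a: "\<And>i. a i = \<alpha> i * s i"
    and \<Phi>: "\<Phi> = p * a True * (1 - a False) + a False * (q + (1 - q) * a True)"
    and \<Phi>_pos: "\<Phi> > 0"
    and regime: "stationary_regime M (joint_step p q \<alpha> s) \<pi> (\<lambda>t \<omega>. (X t \<omega>, Xhat t \<omega>))"
    and C: "importance_aware_consecutive_error M X Xhat C"
  shows "(\<forall>i. \<P>(\<omega> in M. C t \<omega> = i) =
            (if i = 0 then 1 - pmf \<pi> (True, False)
             else p * (1 - q) ^ (i - 1) * (1 - a True) ^ i * pmf \<pi> (False, False))) \<and>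
         (\<P>(\<omega> in M. C t \<omega> = 0) > 0 \<longrightarrow>
            \<P>(\<omega> in M. C (t + 1) \<omega> = 1 \<bar> C t \<omega> = 0) =
              p * (1 - a True) * pmf \<pi> (False, False) / (1 - pmf \<pi> (True, False))) \<and>
         (\<forall>i\<ge>1. \<P>(\<omega> in M. C t \<omega> = i) > 0 \<longrightarrow>
            \<P>(\<omega> in M. C (t + 1) \<omega> = i + 1 \<bar> C t \<omega> = i) = (1 - q) * (1 - a True)) \<and>
         ((\<lambda>x. real x * \<P>(\<omega> in M. C t \<omega> = x)) has_sum
            (p * q * a False * (1 - a True) / ((p + q) * (q + (1 - q) * a True) * \<Phi>))) {1..}"
proof -
  let ?Z = "\<lambda>t \<omega>. (X t \<omega>, Xhat t \<omega>)"
  let ?K = "joint_step p q \<alpha> s"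
  define u where "u = pmf \<pi> (False, False)"
  define v where "v = pmf \<pi> (False, True)"
  define w where "w = pmf \<pi> (True, False)"
  define z where "z = pmf \<pi> (True, True)"
  \<comment> \<open>\<open>c\<close> is the probability of staying in the erroneous state for one
    more slot, and \<open>D\<close> the probability of leaving it.\<close>
  define c where "c = (1 - q) * (1 - a True)"
  define D where "D = q + (1 - q) * a True"
  have a01: "0 \<le> a i" "a i \<le> 1" for i
    using \<alpha>[of i] s[of i] by (simp_all add: a mult_le_one)
  have c01: "0 \<le> c" "c < 1"
  proof -
    show "0 \<le> c" unfolding c_def using q a01[of True] by simp
    have "c \<le> 1 - q" unfolding c_def using q a01[of True] by (simp add: mult_left_le)
    then show "c < 1" using q by simp
  qed
  have Dc: "D = 1 - c" unfolding D_def c_def by (simp add: algebra_simps)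
  have stat: "stationary_distribution ?K \<pi>" and mc: "markov_chain M ?K ?Z"
    using regime by (auto simp: stationary_regime_def)
  interpret prob_space M using mc by (simp add: markov_chain_def)

  have K: "pmf (?K (x, y)) (x', y') = pmf (source_step p q x) x' *
      (a x' * of_bool (y' = x') + (1 - a x') * of_bool (y' = y))" for x y x' y'
    unfolding a using p q s less_imp_le[OF conjunct1[OF \<alpha>]] \<alpha>
    by (intro pmf_joint_step) auto
  have src: "pmf (source_step p q False) True = p" "pmf (source_step p q False) False = 1 - p"
    "pmf (source_step p q True) True = 1 - q" "pmf (source_step p q True) False = q"
    using p q by (simp_all add: source_step_def)
  note balance = stationary_distribution_balance[OF stat, unfolded sum_bool_pairs]
  have bal00: "u = u * (1 - p) + v * ((1 - p) * a False) + w * q + z * (q * a False)"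
    using balance[of "(False, False)"] unfolding u_def v_def w_def z_def by (simp add: K src)
  have bal10: "w = u * (p * (1 - a True)) + w * c"
    using balance[of "(True, False)"] unfolding u_def v_def w_def z_def c_def
    by (simp add: K src)
  have bal01: "v = v * ((1 - p) * (1 - a False)) + z * (q * (1 - a False))"
    using balance[of "(False, True)"] unfolding u_def v_def w_def z_def by (simp add: K src)
  have total: "u + v + w + z = 1"
    using sum_pmf_eq_1[of UNIV \<pi>] unfolding sum_bool_pairs u_def v_def w_def z_def by simp
  \<comment> \<open>Flow out of the erroneous state equals flow into it. The latter comes from
    \<open>(False, False)\<close> alone, since a wrong reconstruction 0 can only be a retained
    one.\<close>
  have wD: "w * D = p * (1 - a True) * u"
    using bal10 unfolding Dc by (simp add: algebra_simps)

  have meas [measurable]: "C t \<in> measurable M (count_space UNIV)"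
    and [measurable]: "?Z t \<in> measurable M (count_space UNIV)" for t
    using C mc by (auto simp: importance_aware_consecutive_error_def markov_chain_def)
  have rec: "AE \<omega> in M. \<forall>t. C (t + 1) \<omega> =
      (if ?Z (t + 1) \<omega> = (True, False) then C t \<omega> + 1 else 0)"
    using C by (simp add: importance_aware_consecutive_error_def)

  have tail: "\<P>(\<omega> in M. n < C t \<omega>) = w * c ^ n" for n t
  proof -
    \<comment> \<open>The null set in \<open>rec\<close> is common to all times, so the
      deterministic unrolling applies along each remaining path.\<close>
    have iff: "AE \<omega> in M. n < C t \<omega> \<longleftrightarrow> (\<forall>k\<le>n. ?Z (t - int k) \<omega> = (True, False))"
      using rec
    proof eventually_elim
      case (elim \<omega>)
      then show ?case
        by (intro consecutive_count_gt_iff[where P = "\<lambda>t. ?Z t \<omega> = (True, False)"]) blast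
    qed
    have "\<P>(\<omega> in M. n < C t \<omega>) = \<P>(\<omega> in M. \<forall>k\<le>n. ?Z (t - int k) \<omega> = (True, False))"
    proof (rule finite_measure_eq_AE)
      show "{\<omega> \<in> space M. \<forall>k\<le>n. ?Z (t - int k) \<omega> = (True, False)} \<in> events"
        by measurable
    qed (use iff in \<open>auto elim: eventually_mono\<close>)
    also have "\<dots> = w * c ^ n"
      unfolding prob_constant_path[OF regime] w_def c_def by (simp add: K src)
    finally show ?thesis .
  qed
  have zero: "\<P>(\<omega> in M. C t \<omega> = 0) = 1 - w" for t
    using prob_neg[of "\<lambda>\<omega>. 0 < C t \<omega>"] tail[of 0 t] by simp
  have Suc: "\<P>(\<omega> in M. C t \<omega> = Suc n) = p * (1 - a True) * u * c ^ n" for n t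
  proof -
    have "\<P>(\<omega> in M. C t \<omega> = Suc n) =
        prob ({\<omega> \<in> space M. n < C t \<omega>} - {\<omega> \<in> space M. Suc n < C t \<omega>})"
      by (rule arg_cong[where f = prob]) auto
    also have "\<dots> = \<P>(\<omega> in M. n < C t \<omega>) - \<P>(\<omega> in M. Suc n < C t \<omega>)"
    proof (rule finite_measure_Diff)
      show "{\<omega> \<in> space M. Suc n < C t \<omega>} \<subseteq> {\<omega> \<in> space M. n < C t \<omega>}"
        using Suc_lessD by blast
    qed measurable
    also have "\<dots> = w * D * c ^ n"
      unfolding tail Dc by (simp add: algebra_simps)
    finally show ?thesis unfolding wD .
  qed
  have trans: "\<P>(\<omega> in M. C (t + 1) \<omega> = i + 1 \<bar> C t \<omega> = i) =
      \<P>(\<omega> in M. C (t + 1) \<omega> = i + 1) / \<P>(\<omega> in M. C t \<omega> = i)" for i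
  proof -
    have "AE \<omega> in M. C (t + 1) \<omega> = i + 1 \<and> C t \<omega> = i \<longleftrightarrow> C (t + 1) \<omega> = i + 1"
      using rec by eventually_elim (auto split: if_splits)
    then have "\<P>(\<omega> in M. C (t + 1) \<omega> = i + 1 \<and> C t \<omega> = i) = \<P>(\<omega> in M. C (t + 1) \<omega> = i + 1)"
      by (intro finite_measure_eq_AE) auto
    then show ?thesis by (simp add: cond_prob_def)
  qed

  have dist: "\<P>(\<omega> in M. C t \<omega> = i) =
      (if i = 0 then 1 - w else p * (1 - q) ^ (i - 1) * (1 - a True) ^ i * u)" for i
    by (cases i) (simp_all add: zero Suc c_def power_mult_distrib)
  have trans0: "\<P>(\<omega> in M. C (t + 1) \<omega> = 1 \<bar> C t \<omega> = 0) = p * (1 - a True) * u / (1 - w)"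
    using trans[of 0] zero Suc[of "t + 1" 0] by simp
  have transS: "\<P>(\<omega> in M. C (t + 1) \<omega> = i + 1 \<bar> C t \<omega> = i) = (1 - q) * (1 - a True)"
    if "1 \<le> i" and "\<P>(\<omega> in M. C t \<omega> = i) > 0" for i
  proof -
    obtain n where i: "i = Suc n" using \<open>1 \<le> i\<close> by (cases i) auto
    \<comment> \<open>The factor to be cancelled can vanish, for instance if
      \<open>a True = 1\<close>; the positive probability of the conditioning event excludes
      this.\<close>
    have nz: "p * (1 - a True) * u * c ^ n \<noteq> 0"
      using that(2)[unfolded i Suc] by (rule less_imp_neq[symmetric])
    have "\<P>(\<omega> in M. C (t + 1) \<omega> = i + 1 \<bar> C t \<omega> = i) =
        (p * (1 - a True) * u * c ^ n) * c / (p * (1 - a True) * u * c ^ n)"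
      using trans[of i] Suc[of "t + 1" "Suc n"] Suc[of t n] unfolding i by (simp add: mult_ac)
    also have "\<dots> = c"
      using nz by (rule nonzero_mult_div_cancel_left)
    finally show ?thesis unfolding c_def .
  qed

  have u: "u * ((p + q) * \<Phi>) = q * a False * D"
  proof -
    \<comment> \<open>Adding the balance equations of the two states with source 0 eliminates the
      reconstruction and leaves the balance of the source alone, whose mass at 0 is
      \<open>u + v\<close>.\<close>
    have "u + v = (1 - p) * (u + v) + q * (w + z)"
      using bal00 bal01 by (simp add: algebra_simps)
    moreover have rest: "w + z = 1 - (u + v)"
      using total by simp
    ultimately have flow: "p * (u + v) = q * (1 - (u + v))"
      by (simp add: algebra_simps)
    have z: "z = 1 - (u + v) - w"
      using rest by simp
    \<comment> \<open>Balance at \<open>(False, False)\<close>, with \<open>v\<close> and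
      \<open>z\<close> expressed through \<open>u\<close>, \<open>w\<close> and the source mass
      \<open>u + v\<close>.\<close>
    have "u * (p + (1 - p) * a False) - q * (1 - a False) * w =
        (1 - p) * a False * (u + v) + a False * (q * (1 - (u + v)))"
      using bal00 unfolding z by (simp add: algebra_simps)
    also have "\<dots> = a False * (u + v)"
      unfolding flow[symmetric] by (simp add: algebra_simps)
    finally have cut: "u * (p + (1 - p) * a False) - q * (1 - a False) * w = a False * (u + v)" .
    \<comment> \<open>Multiplying by \<open>D\<close> allows \<open>w * D\<close> to be replaced by
      a multiple of \<open>u\<close>. The resulting coefficient of \<open>u\<close> is
      \<open>\<Phi>\<close>, because \<open>\<Phi> = (p + (1 - p) * a False) * D - p * q * (1 - a
      False) * (1 - a True)\<close>.\<close>
    have "u * \<Phi> = u * (p + (1 - p) * a False) * D - q * (1 - a False) * (w * D)"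
      unfolding wD unfolding \<Phi> D_def by (simp add: algebra_simps)
    also have "\<dots> = a False * (u + v) * D"
      unfolding cut[symmetric] by (simp add: algebra_simps)
    finally have "u * ((p + q) * \<Phi>) = a False * D * ((p + q) * (u + v))"
      by (simp add: mult_ac)
    also have "(p + q) * (u + v) = q"
      using flow by (simp add: algebra_simps)
    finally show ?thesis by simp
  qed
  \<comment> \<open>The geometric mean contributes \<open>D\<close> squared in the denominator, and
    the closed form of \<open>u\<close> has a factor \<open>D\<close> in its numerator, so a single
    \<open>D\<close> survives.\<close>
  have mean: "p * (1 - a True) * u * (1 / (1 - c)\<^sup>2) =
      p * q * a False * (1 - a True) / ((p + q) * (q + (1 - q) * a True) * \<Phi>)"
  proof -
    have "D > 0" "p + q > 0" using c01 Dc p q by auto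
    then have "u = q * a False * D / ((p + q) * \<Phi>)"
      using u \<Phi>_pos by (simp only: eq_divide_eq) simp
    then show ?thesis
      unfolding Dc[symmetric] D_def[symmetric] using \<open>D > 0\<close> \<open>p + q > 0\<close> \<Phi>_pos
      by (simp add: power2_eq_square mult_ac)
  qed
  have "((\<lambda>x. p * (1 - a True) * u * (real x * c ^ (x - 1))) has_sum
      (p * (1 - a True) * u * (1 / (1 - c)\<^sup>2))) {1..}"
    by (intro has_sum_cmult_right has_sum_geometric_mean c01)
  moreover have "p * (1 - a True) * u * (real x * c ^ (x - 1)) = real x * \<P>(\<omega> in M. C t \<omega> = x)"
    if "x \<in> {1..}" for x
    using that Suc[of t "x - 1"] by simp
  ultimately have sum: "((\<lambda>x. real x * \<P>(\<omega> in M. C t \<omega> = x)) has_sum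
      (p * (1 - a True) * u * (1 / (1 - c)\<^sup>2))) {1..}"
    by (rule has_sum_cong[THEN iffD1, rotated])
  show ?thesis
    using dist trans0 transS sum[unfolded mean] unfolding u_def w_def by blast
qed

end
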